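(* Let $X$ be a compact metric space and let $f:X\to X$ be a continuous map. Then for every point $x\in X$, the special $\alpha$-limit set $s\alpha(x)$ of $x$ under $f$ is an analytic subset of $X$.
   Context: $\mathbb{N}=\{0,1,2,\ldots\}$. A backward orbit of $x$ under $f$ is a sequence $(x_n)_{n\in\mathbb{N}}$ in $X$ with $x_0=x$ and $f(x_{n+1})=x_n$ for all $n\in\mathbb{N}$. For a backward orbit $(x_n)_{n\in\mathbb{N}}$, $\alpha((x_n)_{n=0}^\infty)$ denotes the set of all its accumulation points, i.e. all $y\in X$ such that $x_{n_i}\to y$ along some subsequence $n_i\to\infty$. The special $\alpha$-limit set of $x$ is $s\alpha(x)=\bigcup \alpha((x_n)_{n=0}^\infty)$, the union taken over all backward orbits $(x_n)$ of $x$ (empty if $x$ has no backward orbit). A Polish space is a separable, completely metrizable topological space. A subset $B$ of a Polish space $Y$ is analytic (or $\boldsymbol{\Sigma}^1_1$) if there exist a Polish space $Z$, a Borel subset $A\subset Z$, and a continuous map $g:Z\to Y$ such that $B=g(A)$. *)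

theory Defs
  imports "HOL-Analysis.Analysis"
begin

definition backward_orbit :: "'a set \<Rightarrow> ('a \<Rightarrow> 'a) \<Rightarrow> 'a \<Rightarrow> (nat \<Rightarrow> 'a) \<Rightarrow> bool" where
  "backward_orbit X f x xs \<longleftrightarrow>
     (\<forall>n. xs n \<in> X) \<and> xs 0 = x \<and> (\<forall>n. f (xs (Suc n)) = xs n)"

definition accumulation_points :: "'a topology \<Rightarrow> (nat \<Rightarrow> 'a) \<Rightarrow> 'a set" where
  "accumulation_points T xs =
     {y \<in> topspace T. \<exists>r::nat \<Rightarrow> nat. strict_mono r \<and> limitin T (xs \<circ> r) y sequentially}"

definition special_alpha_limit :: "'a topology \<Rightarrow> ('a \<Rightarrow> 'a) \<Rightarrow> 'a \<Rightarrow> 'a set" where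
  "special_alpha_limit T f x =
     (\<Union>xs \<in> {xs. backward_orbit (topspace T) f x xs}. accumulation_points T xs)"

definition polish_topology :: "'a topology \<Rightarrow> bool" where
  "polish_topology T \<longleftrightarrow> separable_space T \<and> completely_metrizable_space T"

definition borel_in :: "'a topology \<Rightarrow> 'a set \<Rightarrow> bool" where
  "borel_in T A \<longleftrightarrow> A \<in> sigma_sets (topspace T) {U. openin T U}"

text \<open>
  HOL cannot quantify over types inside a formula, so the Polish space \<open>Z\<close> in the definition of an
  analytic set has its points in the fixed type \<^typ>\<open>real\<close>; its topology is an arbitrary one on an
  arbitrary set of reals, unrelated to the usual topology of the line. This loses no
  generality: a Polish space has at most continuum many points, so it is homeomorphic to a space
  of this form. The lemma \<open>analytic_inI\<close> below removes the restriction.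
\<close>

definition analytic_in :: "'a topology \<Rightarrow> 'a set \<Rightarrow> bool" where
  "analytic_in Y B \<longleftrightarrow> polish_topology Y \<and>
     (\<exists>(Z :: real topology) A g.
        polish_topology Z \<and> borel_in Z A \<and> continuous_map Z Y g \<and> B = g ` A)"

lemma polish_topology_homeomorphic:
  assumes "polish_topology T" "T homeomorphic_space T'"
  shows "polish_topology T'"
  using assms homeomorphic_separable_space homeomorphic_completely_metrizable_space
  unfolding polish_topology_def by metis

lemma polish_topology_lepoll_real:
  assumes "polish_topology Z"
  shows "topspace Z \<lesssim> (UNIV :: real set)"
proof -
  obtain M d where "Metric_space M d" and Z: "Z = Metric_space.mtopology M d"
    using assms unfolding polish_topology_def completely_metrizable_space_def by blast
  interpret Metric_space M d by fact
  obtain D where D: "countable D" "D \<subseteq> M" "mtopology closure_of D = M"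
    using assms unfolding polish_topology_def separable_space_def Z by auto
  show ?thesis
  proof (cases "M = {}")
    case True
    then show ?thesis unfolding Z topspace_mtopology by simp
  next
    case False
    with D have "D \<noteq> {}" by auto
    define e where "e = from_nat_into D"
    have e: "range e = D"
      using D \<open>D \<noteq> {}\<close> by (simp add: e_def range_from_nat_into)
    define h where "h x = {prod_encode (n, m) |n m. d x (e n) < inverse (real (Suc m))}" for x
    have "inj_on h M"
    proof (rule inj_onI, rule ccontr)
      fix x y assume xy: "x \<in> M" "y \<in> M" "h x = h y" "x \<noteq> y"
      then have "0 < d x y / 2" by auto
      then obtain m where m: "inverse (real (Suc m)) < d x y / 2"
        using reals_Archimedean by blast
      have "x \<in> mtopology closure_of D" using D xy by simp
      then obtain q where q: "q \<in> D" "q \<in> mball x (inverse (real (Suc m)))"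
        unfolding metric_closure_of by (smt (verit) mem_Collect_eq inverse_positive_iff_positive of_nat_0_less_iff zero_less_Suc)
      then obtain n where n: "q = e n" using e by blast
      have "d x (e n) < inverse (real (Suc m))" using q n by simp
      then have "prod_encode (n, m) \<in> h x" unfolding h_def by blast
      then have "d y (e n) < inverse (real (Suc m))"
        unfolding \<open>h x = h y\<close> unfolding h_def by (auto simp: prod_encode_eq)
      moreover have "d x y \<le> d x (e n) + d y (e n)"
        using triangle' xy q n D by (metis commute subsetD triangle)
      ultimately show False
        using m \<open>d x (e n) < inverse (real (Suc m))\<close> by linarith
    qed
    then have "M \<lesssim> (UNIV :: nat set set)" unfolding lepoll_def by blast
    then show ?thesis
      using nat_sets_eqpoll_reals lepoll_trans2 by (auto simp: Z)
  qed
qed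

lemma homeomorphic_maps_pullback:
  assumes "inj_on h (topspace Z)"
  defines "k \<equiv> inv_into (topspace Z) h"
  shows "homeomorphic_maps Z (pullback_topology (h ` topspace Z) k Z) h k"
proof -
  let ?Z = "pullback_topology (h ` topspace Z) k Z"
  have kh: "k (h z) = z" if "z \<in> topspace Z" for z
    using assms that by simp
  have top: "topspace ?Z = h ` topspace Z"
    by (auto simp: topspace_pullback_topology kh)
  have "continuous_map ?Z Z k"
    using continuous_map_pullback[OF continuous_map_id] by (metis id_comp)
  moreover have "continuous_map Z ?Z h"
    by (rule continuous_map_pullback')
       (auto intro: continuous_map_eq[OF continuous_map_id] simp: kh)
  ultimately show ?thesis
    by (auto simp: homeomorphic_maps_def top kh)
qed

lemma borel_in_homeomorphic_image:
  assumes hk: "homeomorphic_maps Z Z' h k" and "borel_in Z A"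
  shows "borel_in Z' (h ` A)"
proof -
  have hom: "homeomorphic_map Z Z' h"
    using hk homeomorphic_maps_map by blast
  have inj: "inj_on h (topspace Z)" and img: "h ` topspace Z = topspace Z'"
    using hom homeomorphic_imp_injective_map homeomorphic_imp_surjective_map by blast+
  have sub: "{U. openin Z U} \<subseteq> Pow (topspace Z)"
    using openin_subset by blast
  have "A \<in> sigma_sets (topspace Z) {U. openin Z U}"
    using assms by (simp add: borel_in_def)
  then have "h ` A \<in> sigma_sets (topspace Z') {U. openin Z' U}"
  proof induction
    case (Basic a)
    then show ?case
      using hom homeomorphic_imp_open_map open_map_def
      by (metis mem_Collect_eq sigma_sets.Basic)
  next
    case Empty
    then show ?case by (simp add: sigma_sets.Empty)
  next
    case (Compl a)
    have "h ` (topspace Z - a) = topspace Z' - h ` a"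
      using inj_on_image_set_diff[OF inj, of "topspace Z" a] sigma_sets_into_sp[OF sub Compl(1)] img
      by auto
    then show ?case using Compl sigma_sets.Compl by metis
  next
    case (Union a)
    then show ?case by (simp add: image_UN sigma_sets.Union)
  qed
  then show ?thesis by (simp add: borel_in_def)
qed

lemma analytic_inI:
  fixes Z :: "'z topology"
  assumes Y: "polish_topology Y" and Z: "polish_topology Z"
    and A: "borel_in Z A" and g: "continuous_map Z Y g"
  shows "analytic_in Y (g ` A)"
proof -
  obtain h :: "'z \<Rightarrow> real" where h: "inj_on h (topspace Z)"
    using polish_topology_lepoll_real[OF Z] unfolding lepoll_def by blast
  define k where "k = inv_into (topspace Z) h"
  define Z' where "Z' = pullback_topology (h ` topspace Z) k Z"
  have hk: "homeomorphic_maps Z Z' h k"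
    unfolding Z'_def k_def using h by (rule homeomorphic_maps_pullback)
  have "polish_topology Z'"
    using polish_topology_homeomorphic[OF Z] hk homeomorphic_space_def by blast
  moreover have "borel_in Z' (h ` A)"
    using borel_in_homeomorphic_image[OF hk A] .
  moreover have "continuous_map Z' Y (g \<circ> k)"
    using hk g by (auto simp: homeomorphic_maps_def intro: continuous_map_compose)
  moreover have "A \<subseteq> topspace Z"
    using A unfolding borel_in_def
    by (rule sigma_sets_into_sp[rotated]) (use openin_subset in blast)
  then have "g ` A = (g \<circ> k) ` (h ` A)"
    using h by (force simp: k_def image_image)
  ultimately show ?thesis
    using Y unfolding analytic_in_def by blast
qed

lemma (in Metric_space) polish_topology_compact:
  assumes "compact_space mtopology"
  shows "polish_topology mtopology"
proof -
  have "mtotally_bounded M" and "mcomplete"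
    using assms compact_space_eq_mcomplete_mtotally_bounded by auto
  then have "\<forall>n. \<exists>K. finite K \<and> K \<subseteq> M \<and> M \<subseteq> (\<Union>x\<in>K. mball x (inverse (real (Suc n))))"
    unfolding mtotally_bounded_def by simp
  then obtain K where K: "\<And>n. finite (K n)" "\<And>n. K n \<subseteq> M"
      "\<And>n. M \<subseteq> (\<Union>x\<in>K n. mball x (inverse (real (Suc n))))"
    by metis
  have "x \<in> mtopology closure_of (\<Union>n. K n)" if xM: "x \<in> M" for x
    unfolding metric_closure_of
  proof (clarsimp simp: xM)
    fix r :: real assume "0 < r"
    then obtain n where n: "inverse (real (Suc n)) < r"
      using reals_Archimedean by blast
    obtain y where "y \<in> K n" "x \<in> mball y (inverse (real (Suc n)))"
      using subsetD[OF K(3)[of n] xM] by blast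
    with n show "\<exists>n. \<exists>y\<in>K n. y \<in> M \<and> d x y < r"
      by (force simp: commute)
  qed
  then have "mtopology closure_of (\<Union>n. K n) = M"
    using closure_of_subset_topspace by fastforce
  moreover have "countable (\<Union>n. K n)" using K by (simp add: uncountable_infinite countable_finite)
  ultimately have "separable_space mtopology"
    unfolding separable_space_def using K(2) by (metis UN_least topspace_mtopology)
  then show ?thesis
    using \<open>mcomplete\<close> completely_metrizable_space_mtopology by (simp add: polish_topology_def)
qed

end

theory Submission
  imports Defs
begin

text \<open>
  In the compact metrizable space \<open>X\<^sup>\<nat> \<times> X\<close>, the pairs of a backward orbit of \<open>x\<close> and an
  accumulation point of it form the intersection of a closed set (the orbit equations) with a
  \<open>G\<^sub>\<delta>\<close> set (for all \<open>k, m\<close> some term of index at least \<open>m\<close> lies within \<open>1/(k+1)\<close> of the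
  point). The special \<open>\<alpha>\<close>-limit set is the second projection of this Borel set.
\<close>

lemma polish_topology_compact_metrizable:
  assumes "compact_space T" "metrizable_space T"
  shows "polish_topology T"
  using assms Metric_space.polish_topology_compact unfolding metrizable_space_def by blast

text \<open>Since witnesses for each \<open>k\<close> occur arbitrarily late, each one can be chosen
  beyond its predecessor. Letting \<open>P\<close> tighten with \<open>k\<close> turns infinitely
  many closeness conditions into one convergent subsequence.\<close>

lemma strict_mono_subsequence:
  assumes "\<And>k m :: nat. \<exists>n\<ge>m. P k n"
  shows "\<exists>r :: nat \<Rightarrow> nat. strict_mono r \<and> (\<forall>k. P k (r k))"
proof -
  have "\<exists>r. \<forall>k. P k (r k) \<and> r k < r (Suc k)"
  proof (rule dependent_nat_choice)
    show "\<exists>n. P 0 n" using assms by blast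
    show "\<exists>n'. P (Suc k) n' \<and> n < n'" for n k using assms[of "Suc n" "Suc k"] by auto
  qed
  then show ?thesis by (auto simp: strict_mono_Suc_iff)
qed

text \<open>This trades the quantifier over subsequences, which has uncountable range, for
  quantifiers over natural numbers, so that being an accumulation point becomes a Borel condition on
  the pair of \<open>xs\<close> and \<open>y\<close>.\<close>

lemma (in Metric_space) accumulation_points_mtopology:
  assumes xs: "\<And>n. xs n \<in> M"
  shows "y \<in> accumulation_points mtopology xs \<longleftrightarrow>
    y \<in> M \<and> (\<forall>k m. \<exists>n\<ge>m. d (xs n) y < inverse (real (Suc k)))"
proof (intro iffI conjI allI; (elim conjE)?)
  assume "y \<in> accumulation_points mtopology xs"
  then obtain r :: "nat \<Rightarrow> nat" where y: "y \<in> M" and r: "strict_mono r"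
    and lim: "limitin mtopology (xs \<circ> r) y sequentially"
    by (auto simp: accumulation_points_def)
  show "y \<in> M" by fact
  fix k m
  obtain N where N: "\<And>n. n \<ge> N \<Longrightarrow> d (xs (r n)) y < inverse (real (Suc k))"
    using lim unfolding limit_metric_sequentially
    by (metis comp_apply inverse_positive_iff_positive of_nat_0_less_iff zero_less_Suc)
  \<comment> \<open>A strictly increasing \<open>r\<close> satisfies \<open>j \<le> r j\<close>, so
    the position \<open>max m N\<close> makes the index late enough and the term close enough at
    once.\<close>
  have "r (max m N) \<ge> m"
    using seq_suble[OF r, of "max m N"] by linarith
  then show "\<exists>n\<ge>m. d (xs n) y < inverse (real (Suc k))"
    using N[of "max m N"] by auto
next
  assume y: "y \<in> M" and *: "\<forall>k m. \<exists>n\<ge>m. d (xs n) y < inverse (real (Suc k))"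
  then obtain r :: "nat \<Rightarrow> nat" where r: "strict_mono r"
    and close: "\<And>k. d (xs (r k)) y < inverse (real (Suc k))"
    using strict_mono_subsequence[of "\<lambda>k n. d (xs n) y < inverse (real (Suc k))"] by blast
  have "limitin mtopology (xs \<circ> r) y sequentially"
    unfolding limit_metric_sequentially
  proof (intro conjI allI impI y)
    fix e :: real assume "e > 0"
    then obtain N where N: "inverse (real (Suc N)) < e"
      using reals_Archimedean by blast
    have "d (xs (r n)) y < e" if "n \<ge> N" for n
    proof -
      have "inverse (real (Suc n)) \<le> inverse (real (Suc N))"
        using that by (simp add: le_imp_inverse_le)
      then show ?thesis using close[of n] N by linarith
    qed
    then show "\<exists>N. \<forall>n\<ge>N. (xs \<circ> r) n \<in> M \<and> d ((xs \<circ> r) n) y < e"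
      using xs by auto
  qed
  with y r show "y \<in> accumulation_points mtopology xs"
    by (auto simp: accumulation_points_def)
qed

lemma borel_in_openin: "openin Z U \<Longrightarrow> borel_in Z U"
  by (auto simp: borel_in_def)

text \<open>In this form the closure rules of \<open>sigma_algebra\<close> for sets defined by
  countable quantifiers apply to \<open>borel_in\<close>.\<close>

lemma sigma_algebra_borel_in: "sigma_algebra (topspace Z) {A. borel_in Z A}"
  unfolding borel_in_def Collect_mem_eq
  by (rule sigma_algebra_sigma_sets) (auto dest: openin_subset)

lemma borel_in_closedin:
  assumes "closedin Z C"
  shows "borel_in Z C"
proof -
  interpret sigma_algebra "topspace Z" "{A. borel_in Z A}"
    by (rule sigma_algebra_borel_in)
  have "borel_in Z (topspace Z - C)" using assms by (intro borel_in_openin) blast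
  then have "borel_in Z (topspace Z - (topspace Z - C))" using compl_sets by blast
  moreover have "topspace Z - (topspace Z - C) = C" using closedin_subset[OF assms] by blast
  ultimately show ?thesis by simp
qed

theorem theorem1:
  fixes X :: "'a set" and d :: "'a \<Rightarrow> 'a \<Rightarrow> real" and f :: "'a \<Rightarrow> 'a" and x :: 'a
  defines "T \<equiv> Metric_space.mtopology X d"
  assumes "Metric_space X d"
    and "compact_space T"
    and "continuous_map T T f"
    and "x \<in> X"
  shows "analytic_in T (special_alpha_limit T f x)"
proof -
  interpret Metric_space X d by fact
  have T: "T = mtopology" by (simp add: T_def)
  have met: "metrizable_space T"
    unfolding T by (rule metrizable_space_mtopology)
  define P where "P = product_topology (\<lambda>_ :: nat. T) UNIV"
  define Z where "Z = prod_topology P T"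
  have topZ: "topspace Z = {(xs, y). (\<forall>n. xs n \<in> X) \<and> y \<in> X}"
    by (auto simp: Z_def P_def T PiE_UNIV_domain)
  \<comment> \<open>Compactness is Tychonoff's theorem; metrizability passes to the power because
    the index set \<open>nat\<close> is countable.\<close>
  have polZ: "polish_topology Z"
  proof (rule polish_topology_compact_metrizable)
    show "compact_space Z"
      unfolding Z_def P_def using assms(3)
      by (simp add: compact_space_prod_topology compact_space_product_topology)
    show "metrizable_space Z"
      unfolding Z_def P_def using met
      by (simp add: metrizable_space_prod_topology metrizable_space_product_topology)
  qed
  have snd: "continuous_map Z T snd"
    unfolding Z_def by (rule continuous_map_snd)
  have coord: "continuous_map Z T (\<lambda>z. fst z n)" for n
    using continuous_map_compose[OF continuous_map_fst
        continuous_map_product_projection[of n UNIV "\<lambda>_. T"]]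
    by (simp add: Z_def P_def o_def)
  have f_coord: "continuous_map Z T (\<lambda>z. f (fst z n))" for n
    using continuous_map_compose[OF coord assms(4)] by (simp add: o_def)
  have haus: "Hausdorff_space T"
    unfolding T by (rule Hausdorff_space_mtopology)
  \<comment> \<open>The set where two continuous maps into a Hausdorff space agree is closed; here
    one of them is the constant map \<open>x\<close>.\<close>
  have start: "borel_in Z {z \<in> topspace Z. fst z 0 = x}"
    by (intro borel_in_closedin closedin_continuous_maps_eq[OF haus] coord)
      (simp add: T assms(5))
  have orbit: "borel_in Z {z \<in> topspace Z. f (fst z (Suc n)) = fst z n}" for n
    by (intro borel_in_closedin closedin_continuous_maps_eq[OF haus] coord f_coord)
  have near: "borel_in Z {z \<in> topspace Z. d (fst z n) (snd z) < e}" for n e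
  proof (rule borel_in_openin)
    have "continuous_map Z euclideanreal (\<lambda>z. d (fst z n) (snd z))"
      using continuous_map_mdist[of Z "metric (X, d)" "\<lambda>z. fst z n" snd] coord snd
      by (simp add: T mtopology_of_def mspace_metric mdist_metric)
    from openin_continuous_map_preimage[OF this, of "{..<e}"]
    show "openin Z {z \<in> topspace Z. d (fst z n) (snd z) < e}" by simp
  qed
  define A where "A = {z \<in> topspace Z. fst z 0 = x \<and> (\<forall>n. f (fst z (Suc n)) = fst z n) \<and>
    (\<forall>k m. \<exists>n. n \<ge> m \<and> d (fst z n) (snd z) < inverse (real (Suc k)))}"
  interpret B: sigma_algebra "topspace Z" "{A. borel_in Z A}"
    by (rule sigma_algebra_borel_in)
  \<comment> \<open>All quantifiers in \<open>A\<close> range over \<open>nat\<close>, so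
    \<open>A\<close> arises from the sets in \<open>start\<close>, \<open>orbit\<close> and
    \<open>near\<close> by countable unions and intersections.\<close>
  have "A \<in> {A. borel_in Z A}"
    unfolding A_def
    by (intro B.sets_Collect_conj B.sets_Collect_countable_All B.sets_Collect_countable_Ex
        B.sets_Collect_const)
      (auto intro: start orbit near)
  \<comment> \<open>The points of \<open>Z\<close> are not reals; \<open>analytic_inI\<close>
    carries \<open>Z\<close> over to a Polish space on a set of reals.\<close>
  then have "analytic_in T (snd ` A)"
    using analytic_inI[OF _ polZ _ snd] polish_topology_compact_metrizable[OF assms(3) met] by simp
  moreover have "special_alpha_limit T f x = snd ` A"
  proof -
    have "y \<in> special_alpha_limit T f x \<longleftrightarrow> (\<exists>xs. (xs, y) \<in> A)" for y
    proof -
      have "backward_orbit X f x xs \<and> y \<in> accumulation_points T xs \<longleftrightarrow> (xs, y) \<in> A" for xs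
      \<comment> \<open>The metric description of accumulation points is available only for
        sequences in \<open>X\<close>; for any other \<open>xs\<close> both sides are false.\<close>
      proof (cases "\<forall>n. xs n \<in> X")
        case True
        then show ?thesis
          using accumulation_points_mtopology[of xs y]
          by (auto simp: A_def topZ T backward_orbit_def)
      next
        case False
        then show ?thesis by (auto simp: A_def topZ backward_orbit_def)
      qed
      then show ?thesis by (auto simp: special_alpha_limit_def T)
    qed
    then show ?thesis by force
  qed
  ultimately show ?thesis by simp
qed

end
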